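(* Let $\{M_0(t)\}_{t\ge0}$ and $\{M(t)\}_{t\ge0}$ be independent generalized counting processes with positive rates $\mu_1,\dots,\mu_{k_0}$ and $\lambda_1,\dots,\lambda_k$, respectively. The Lévy measure of the Lévy process $\hat M(t)=M(M_0(t))$, $t\ge0$, is $$\Pi_{\hat M}(\mathrm{d}x)=\sum_{j_0=1}^{k_0}\mu_{j_0}\sum_{n=1}^{\infty}\sum_{\Omega(k,n)}\Big(\prod_{j=1}^{k}\frac{(j_0\lambda_j)^{n_j}}{n_j!}e^{-j_0\lambda_j}\Big)\delta_n(\mathrm{d}x),$$ where $\delta_n$ denotes the Dirac measure at $n$.
   Context: A generalized counting process (GCP) $\{M(t)\}_{t\ge0}$ with positive rates $\lambda_1,\dots,\lambda_k$ is a right-continuous $\mathbb{N}_0$-valued process with $M(0)=0$ and stationary independent increments, whose probability generating function is $\mathbb{E}(u^{M(t)})=\exp\big(-t\sum_{j=1}^{k}\lambda_j(1-u^j)\big)$, $|u|\le1$. The process $\hat M(t)=M(M_0(t))$ is called the iterated generalized counting process (IGCP); it is a Lévy process, being a composition of two independent Lévy processes. $\Omega(k,n)=\{(n_1,\dots,n_k)\in\mathbb{N}_0^k: n_1+2n_2+\dots+kn_k=n\}$, and the sum over $\Omega(k,n)$ runs over all its elements. *)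

theory Defs
  imports "HOL-Probability.Probability"
begin

text \<open>
  Processes are indexed by the reals; only the times \<open>t \<ge> 0\<close> are ever constrained.
\<close>

definition stationary_increments :: "'a measure \<Rightarrow> (real \<Rightarrow> 'a \<Rightarrow> real) \<Rightarrow> bool" where
  "stationary_increments P X \<longleftrightarrow>
     (\<forall>s t. 0 \<le> s \<and> s \<le> t \<longrightarrow>
        distr P borel (\<lambda>\<omega>. X t \<omega> - X s \<omega>) = distr P borel (X (t - s)))"

definition independent_increments :: "'a measure \<Rightarrow> (real \<Rightarrow> 'a \<Rightarrow> real) \<Rightarrow> bool" where
  "independent_increments P X \<longleftrightarrow>
     (\<forall>n (\<tau>::nat \<Rightarrow> real). 0 \<le> \<tau> 0 \<and> strict_mono_on {..n} \<tau> \<longrightarrow>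
        prob_space.indep_vars P (\<lambda>_. borel) (\<lambda>i \<omega>. X (\<tau> (Suc i)) \<omega> - X (\<tau> i) \<omega>) {..<n})"

definition stochastically_continuous :: "'a measure \<Rightarrow> (real \<Rightarrow> 'a \<Rightarrow> real) \<Rightarrow> bool" where
  "stochastically_continuous P X \<longleftrightarrow>
     (\<forall>s\<ge>0. \<forall>\<epsilon>>0.
        ((\<lambda>t. measure P {\<omega> \<in> space P. \<bar>X t \<omega> - X s \<omega>\<bar> > \<epsilon>}) \<longlongrightarrow> 0) (at s within {0..}))"

definition levy_process :: "'a measure \<Rightarrow> (real \<Rightarrow> 'a \<Rightarrow> real) \<Rightarrow> bool" where
  "levy_process P X \<longleftrightarrow>
     prob_space P \<and>
     (\<forall>t\<ge>0. X t \<in> borel_measurable P) \<and>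
     (AE \<omega> in P. X 0 \<omega> = 0) \<and>
     independent_increments P X \<and>
     stationary_increments P X \<and>
     stochastically_continuous P X"

text \<open>
  The Levy measure of a Levy process is the measure \<open>\<nu>\<close> of its Levy--Khintchine triplet
  \<open>(b, \<sigma>2, \<nu>)\<close>, here with truncation function \<open>x \<mapsto> x\<close> on \<open>\<bar>x\<bar> \<le> 1\<close>. The choice of truncation
  only affects the drift \<open>b\<close>, not \<open>\<nu>\<close>.
\<close>

definition is_levy_measure :: "'a measure \<Rightarrow> (real \<Rightarrow> 'a \<Rightarrow> real) \<Rightarrow> real measure \<Rightarrow> bool" where
  "is_levy_measure P X \<nu> \<longleftrightarrow>
     levy_process P X \<and>
     sets \<nu> = sets borel \<and>
     emeasure \<nu> {0} = 0 \<and>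
     (\<integral>\<^sup>+x. ennreal (min 1 (x\<^sup>2)) \<partial>\<nu>) < \<infinity> \<and>
     (\<exists>b \<sigma>2 :: real. 0 \<le> \<sigma>2 \<and>
        (\<forall>t\<ge>0. \<forall>\<theta>. char (distr P borel (X t)) \<theta> =
           exp (of_real t *
             (\<i> * of_real (b * \<theta>) - of_real (\<sigma>2 * \<theta>\<^sup>2 / 2) +
              (CLINT x|\<nu>. iexp (\<theta> * x) - 1 - \<i> * of_real (\<theta> * x * indicator {-1..1} x))))))"

text \<open>
  Increments are taken in \<open>real\<close>, since truncated subtraction on \<open>nat\<close> would change
  their meaning.
\<close>

definition gcp :: "'a measure \<Rightarrow> nat \<Rightarrow> (nat \<Rightarrow> real) \<Rightarrow> (real \<Rightarrow> 'a \<Rightarrow> nat) \<Rightarrow> bool" where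
  "gcp P k lam M \<longleftrightarrow>
     (\<forall>t\<ge>0. M t \<in> measurable P (count_space UNIV)) \<and>
     (AE \<omega> in P. M 0 \<omega> = 0) \<and>
     (AE \<omega> in P. \<forall>t\<ge>0. continuous (at_right t) (\<lambda>s. M s \<omega>)) \<and>
     independent_increments P (\<lambda>t \<omega>. real (M t \<omega>)) \<and>
     stationary_increments P (\<lambda>t \<omega>. real (M t \<omega>)) \<and>
     (\<forall>t\<ge>0. \<forall>u::complex. norm u \<le> 1 \<longrightarrow>
        (CLINT \<omega>|P. u ^ M t \<omega>) =
          exp (- of_real t * (\<Sum>j=1..k. of_real (lam j) * (1 - u ^ j))))"

text \<open>Independence of whole processes, as path-valued random variables.\<close>

definition independent_processes ::
  "'a measure \<Rightarrow> (real \<Rightarrow> 'a \<Rightarrow> nat) \<Rightarrow> (real \<Rightarrow> 'a \<Rightarrow> nat) \<Rightarrow> bool" where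
  "independent_processes P X Y \<longleftrightarrow>
     prob_space.indep_var P
       (PiM {0..} (\<lambda>_. count_space UNIV)) (\<lambda>\<omega>. \<lambda>t\<in>{0..}. X t \<omega>)
       (PiM {0..} (\<lambda>_. count_space UNIV)) (\<lambda>\<omega>. \<lambda>t\<in>{0..}. Y t \<omega>)"

definition igcp :: "(real \<Rightarrow> 'a \<Rightarrow> nat) \<Rightarrow> (real \<Rightarrow> 'a \<Rightarrow> nat) \<Rightarrow> real \<Rightarrow> 'a \<Rightarrow> nat" where
  "igcp M0 M t \<omega> = M (real (M0 t \<omega>)) \<omega>"

text \<open>Extensional functions represent the tuples \<open>(n\<^sub>1, \<dots>, n\<^sub>k)\<close> uniquely.\<close>

definition Omega :: "nat \<Rightarrow> nat \<Rightarrow> (nat \<Rightarrow> nat) set" where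
  "Omega k n = {\<nu> \<in> {1..k} \<rightarrow>\<^sub>E UNIV. (\<Sum>j=1..k. j * \<nu> j) = n}"

lemma finite_Omega: "finite (Omega k n)"
proof (rule finite_subset)
  show "Omega k n \<subseteq> {1..k} \<rightarrow>\<^sub>E {..n}"
  proof
    fix \<nu> assume \<nu>: "\<nu> \<in> Omega k n"
    have "\<nu> j \<le> n" if j: "j \<in> {1..k}" for j
    proof -
      have "\<nu> j \<le> j * \<nu> j" using j by simp
      also have "\<dots> \<le> (\<Sum>i=1..k. i * \<nu> i)"
        by (rule member_le_sum[OF j]) auto
      finally show ?thesis using \<nu> by (simp add: Omega_def)
    qed
    then show "\<nu> \<in> {1..k} \<rightarrow>\<^sub>E {..n}"
      using \<nu> by (auto simp: Omega_def PiE_iff)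
  qed
  show "finite ({1..k} \<rightarrow>\<^sub>E {..n})" by (intro finite_PiE) auto
qed

text \<open>
  \<open>measure_of\<close> yields the zero measure if its argument is not countably additive; this
  does not happen for series of Dirac measures.
\<close>

lemma emeasure_dirac_series:
  fixes c :: "'i \<Rightarrow> ennreal" and w :: "'i \<Rightarrow> nat \<Rightarrow> 'j \<Rightarrow> ennreal"
  assumes "A \<in> sets borel"
  shows "emeasure (measure_of UNIV (sets borel)
            (\<lambda>A. \<Sum>i\<in>I. c i * (\<Sum>n. \<Sum>j\<in>J n. w i n j * emeasure (return borel (x n :: real)) A))) A
       = (\<Sum>i\<in>I. c i * (\<Sum>n. \<Sum>j\<in>J n. w i n j * emeasure (return borel (x n)) A))"
    (is "emeasure (measure_of _ _ ?\<mu>) A = _")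
proof -
  have "emeasure (measure_of UNIV (sets borel) ?\<mu>) A = ?\<mu> A"
  proof (rule emeasure_measure_of_sigma)
    show "sigma_algebra UNIV (sets (borel :: real measure))"
      using sets.sigma_algebra_axioms[of "borel :: real measure"] by simp
    show "positive (sets borel) ?\<mu>" by (simp add: positive_def)
    show "countably_additive (sets borel) ?\<mu>"
    proof (rule countably_additiveI)
      fix B :: "nat \<Rightarrow> real set"
      assume B: "range B \<subseteq> sets borel" "disjoint_family B"
      have S: "(\<Sum>m. emeasure (return borel (x n)) (B m)) = emeasure (return borel (x n)) (\<Union>m. B m)" for n
        using B by (intro suminf_emeasure) auto
      have swap: "(\<Sum>m n. g m n) = (\<Sum>n m. g m n)" for g :: "nat \<Rightarrow> nat \<Rightarrow> ennreal"
        using nn_integral_suminf[of "\<lambda>n m. g m n" "count_space UNIV"]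
        by (simp add: nn_integral_count_space_nat)
      have "(\<Sum>m. ?\<mu> (B m)) =
          (\<Sum>i\<in>I. c i * (\<Sum>m n. \<Sum>j\<in>J n. w i n j * emeasure (return borel (x n)) (B m)))"
        by (subst suminf_sum) (auto intro!: sum.cong)
      also have "\<dots> =
          (\<Sum>i\<in>I. c i * (\<Sum>n m. \<Sum>j\<in>J n. w i n j * emeasure (return borel (x n)) (B m)))"
        by (subst swap) (rule refl)
      also have "\<dots> = ?\<mu> (\<Union>m. B m)"
        by (simp add: suminf_sum S flip: S)
      finally show "(\<Sum>m. ?\<mu> (B m)) = ?\<mu> (\<Union>m. B m)" .
    qed
  qed (use assms in auto)
  then show ?thesis .
qed

end

theory Submission
  imports Defs
begin

text \<open>
  By independence one may freeze the path of \<open>M0\<close>. The increments of \<open>M(M0(t))\<close> then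
  are increments of \<open>M\<close> over disjoint intervals with integer endpoints, so each probability
  involving them factorises into functions of the increments of \<open>M0\<close> alone; this transfers the
  Levy property from the two processes to the composition. Freezing \<open>M0\<close> also gives
  \<open>E u^(M(M0(t))) = E v^(M0(t)) = exp (- t * (\<Sum>j0. \<mu> j0 * (1 - v ^ j0)))\<close> with
  \<open>v = E u^(M(1))\<close>. Finally \<open>v ^ j0\<close> is the generating function of \<open>\<Sum>j. j * N j\<close> for independent
  Poisson variables \<open>N j\<close> of rates \<open>j0 * lam j\<close>, whose law is the inner double sum of the claimed
  measure, apart from the atom at \<open>0\<close>, to which the Levy--Khintchine integrand is blind.
\<close>

section \<open>Generalized counting processes\<close>

lemma (in prob_space) gcp_measurable:
  assumes "gcp M k lam N" "0 \<le> t"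
  shows "N t \<in> measurable M (count_space UNIV)"
  using assms by (simp add: gcp_def)

lemma (in prob_space) gcp_pgf:
  fixes u :: complex
  assumes "gcp M k lam N" "0 \<le> t" "norm u \<le> 1"
  shows "(CLINT \<omega>|M. u ^ N t \<omega>) = exp (- of_real t * (\<Sum>j=1..k. of_real (lam j) * (1 - u ^ j)))"
  using assms unfolding gcp_def by blast

text \<open>By stationarity the increment has the law of \<open>N (t - s)\<close>, a variable with
  values in the naturals, so it is almost surely nonnegative. The exceptional null set may depend on
  \<open>s\<close> and \<open>t\<close>.\<close>

lemma (in prob_space) gcp_mono_AE:
  assumes N: "gcp M k lam N" and st: "0 \<le> s" "s \<le> t"
  shows "AE \<omega> in M. N s \<omega> \<le> N t \<omega>"
proof -
  have [measurable]: "N r \<in> measurable M (count_space UNIV)" if "0 \<le> r" for r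
    using gcp_measurable[OF N that] .
  have eq: "distr M borel (\<lambda>\<omega>. real (N t \<omega>) - real (N s \<omega>)) = distr M borel (\<lambda>\<omega>. real (N (t - s) \<omega>))"
    using N st by (auto simp: gcp_def stationary_increments_def)
  have "AE x in distr M borel (\<lambda>\<omega>. real (N (t - s) \<omega>)). 0 \<le> x"
    using st by (subst AE_distr_iff) auto
  then have "AE \<omega> in M. 0 \<le> real (N t \<omega>) - real (N s \<omega>)"
    unfolding eq[symmetric] using st by (subst (asm) AE_distr_iff) auto
  then show ?thesis by eventually_elim simp
qed

text \<open>This is the generating function at \<open>u = 0\<close>: since \<open>0 ^ 0 = 1\<close>,
  the variable \<open>0 ^ N t\<close> is the indicator of the event that \<open>N t\<close>
  vanishes.\<close>

lemma (in prob_space) gcp_prob_zero: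
  assumes N: "gcp M k lam N" and t: "0 \<le> t"
  shows "prob {\<omega> \<in> space M. N t \<omega> = 0} = exp (- t * (\<Sum>j=1..k. lam j))"
proof -
  have [measurable]: "N t \<in> measurable M (count_space UNIV)"
    using gcp_measurable[OF N t] .
  have "complex_of_real (prob {\<omega> \<in> space M. N t \<omega> = 0}) = (CLINT \<omega>|M. of_real (indicator {\<omega> \<in> space M. N t \<omega> = 0} \<omega>))"
    by (subst integral_complex_of_real) simp
  also have "\<dots> = (CLINT \<omega>|M. (0 :: complex) ^ N t \<omega>)"
    by (intro Bochner_Integration.integral_cong) (auto simp: indicator_def)
  also have "\<dots> = exp (- of_real t * (\<Sum>j=1..k. of_real (lam j) * (1 - 0 ^ j)))"
    by (rule gcp_pgf[OF N t]) simp
  also have "(\<Sum>j=1..k. complex_of_real (lam j) * (1 - 0 ^ j)) = of_real (\<Sum>j=1..k. lam j)"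
    by (auto intro!: sum.cong)
  also have "exp (- complex_of_real t * of_real (\<Sum>j=1..k. lam j)) = of_real (exp (- t * (\<Sum>j=1..k. lam j)))"
    by (simp add: exp_of_real[symmetric])
  finally show ?thesis by (simp only: of_real_eq_iff)
qed

text \<open>Stationarity reduces the event to \<open>N (t - s)\<close> being zero. The absolute
  value covers both orders of the times, as the two-sided limit in stochastic continuity
  requires.\<close>

lemma (in prob_space) gcp_prob_increment_zero:
  assumes N: "gcp M k lam N" and st: "0 \<le> s" "0 \<le> t"
  shows "prob {\<omega> \<in> space M. N t \<omega> = N s \<omega>} = exp (- \<bar>t - s\<bar> * (\<Sum>j=1..k. lam j))"
proof -
  have *: "prob {\<omega> \<in> space M. N t \<omega> = N s \<omega>} = exp (- (t - s) * (\<Sum>j=1..k. lam j))"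
    if st: "0 \<le> s" "s \<le> t" for s t
  proof -
    have [measurable]: "N r \<in> measurable M (count_space UNIV)" if "0 \<le> r" for r
      using gcp_measurable[OF N that] .
    have [measurable]: "N t \<in> measurable M (count_space UNIV)" "N s \<in> measurable M (count_space UNIV)"
      "N (t - s) \<in> measurable M (count_space UNIV)" using st by auto
    have eq: "distr M borel (\<lambda>\<omega>. real (N t \<omega>) - real (N s \<omega>)) = distr M borel (\<lambda>\<omega>. real (N (t - s) \<omega>))"
      using N st by (auto simp: gcp_def stationary_increments_def)
    have "prob {\<omega> \<in> space M. N t \<omega> = N s \<omega>} = measure (distr M borel (\<lambda>\<omega>. real (N t \<omega>) - real (N s \<omega>))) {0}"
      by (subst measure_distr) (auto intro!: arg_cong[where f = prob])
    also have "\<dots> = prob {\<omega> \<in> space M. N (t - s) \<omega> = 0}"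
      unfolding eq by (subst measure_distr) (auto intro!: arg_cong[where f = prob])
    also have "\<dots> = exp (- (t - s) * (\<Sum>j=1..k. lam j))"
      using st by (intro gcp_prob_zero[OF N]) auto
    finally show ?thesis .
  qed
  show ?thesis
  proof (cases "s \<le> t")
    case True
    then show ?thesis using *[of s t] st by simp
  next
    case False
    moreover have "{\<omega> \<in> space M. N t \<omega> = N s \<omega>} = {\<omega> \<in> space M. N s \<omega> = N t \<omega>}" by auto
    ultimately show ?thesis using *[of t s] st by simp
  qed
qed

text \<open>
  Independence is only postulated along strictly increasing times. An increment over an integer
  interval is a sum of unit increments, and the sums over disjoint, possibly empty, blocks are
  independent.
\<close>

lemma (in prob_space) indep_vars_increments_nat:
  fixes X :: "real \<Rightarrow> 'a \<Rightarrow> real" and m :: "nat \<Rightarrow> nat"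
  assumes X: "independent_increments M X" and m: "mono_on {..n} m"
  shows "indep_vars (\<lambda>_. borel) (\<lambda>i \<omega>. X (real (m (Suc i))) \<omega> - X (real (m i)) \<omega>) {..<n}"
proof -
  define D where "D l \<omega> = X (real (Suc l)) \<omega> - X (real l) \<omega>" for l \<omega>
  define K where "K i = {m i..<m (Suc i)}" for i
  have mono: "m i \<le> m j" if "i \<le> j" "j \<le> n" for i j
    using m that by (auto simp: mono_on_def)
  have "indep_vars (\<lambda>_. borel) D {..<m n}"
    using X unfolding independent_increments_def D_def
    by (elim allE[of _ "m n"] allE[of _ real]) (auto simp: strict_mono_on_def)
  moreover have "K i \<subseteq> {..<m n}" if "i \<in> {..<n}" for i
    using mono[of "Suc i" n] that by (auto simp: K_def)
  moreover have "disjoint_family_on K {..<n}"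
  proof -
    have "K i \<inter> K j = {}" if "i < j" "j < n" for i j
      using mono[of "Suc i" j] that by (auto simp: K_def)
    then show ?thesis
      by (fastforce simp: disjoint_family_on_def neq_iff)
  qed
  ultimately have "indep_vars (\<lambda>i. PiM (K i) (\<lambda>_. borel)) (\<lambda>i \<omega>. restrict (\<lambda>l. D l \<omega>) (K i)) {..<n}"
    by (rule indep_vars_restrict)
  then have "indep_vars (\<lambda>_. borel) (\<lambda>i \<omega>. (\<Sum>l\<in>K i. restrict (\<lambda>l. D l \<omega>) (K i) l)) {..<n}"
    by (rule indep_vars_compose2) simp
  moreover have "(\<Sum>l\<in>K i. restrict (\<lambda>l. D l \<omega>) (K i) l) = X (real (m (Suc i))) \<omega> - X (real (m i)) \<omega>"
    if "i \<in> {..<n}" for i \<omega>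
  proof -
    have "(\<Sum>l\<in>K i. restrict (\<lambda>l. D l \<omega>) (K i) l) = (\<Sum>l=m i..<m (Suc i). D l \<omega>)"
      by (auto simp: K_def intro!: sum.cong)
    also have "\<dots> = X (real (m (Suc i))) \<omega> - X (real (m i)) \<omega>"
      unfolding D_def using mono[of i "Suc i"] that
      by (subst sum_Suc_diff'[of _ _ "\<lambda>l. X (real l) \<omega>"]) auto
    finally show ?thesis .
  qed
  ultimately show ?thesis
    by (subst indep_vars_cong[OF refl, of _ _ "\<lambda>i \<omega>. (\<Sum>l\<in>K i. restrict (\<lambda>l. D l \<omega>) (K i) l)"]) auto
qed

section \<open>Integrating out one of two independent variables\<close>

text \<open>Independence makes the joint law a product, so Fubini applies. The integrand sees
  \<open>Y\<close> only through the countably valued \<open>g\<close>; this makes it jointly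
  measurable as soon as each \<open>f c\<close> is measurable, which is what evaluating a path at a
  random time calls for.\<close>

lemma (in prob_space) indep_var_expectation_Fubini:
  fixes f :: "'c::countable \<Rightarrow> 'd \<Rightarrow> 'e::{banach, second_countable_topology}"
  assumes ind: "indep_var L Y N Z" and g [measurable]: "g \<in> measurable L (count_space UNIV)"
    and f [measurable]: "\<And>c. f c \<in> borel_measurable N" and C: "\<And>c z. norm (f c z) \<le> C"
  shows "(LINT \<omega>|M. f (g (Y \<omega>)) (Z \<omega>)) = (LINT \<omega>|M. LINT \<omega>'|M. f (g (Y \<omega>)) (Z \<omega>'))"
proof -
  let ?D = "distr M L Y" and ?E = "distr M N Z"
  have YZ [measurable]: "Y \<in> measurable M L" "Z \<in> measurable M N"
    and eq: "?D \<Otimes>\<^sub>M ?E = distr M (L \<Otimes>\<^sub>M N) (\<lambda>\<omega>. (Y \<omega>, Z \<omega>))"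
    using ind by (auto simp: indep_var_distribution_eq)
  interpret D: prob_space ?D by (rule prob_space_distr) simp
  interpret E: prob_space ?E by (rule prob_space_distr) simp
  interpret DE: pair_prob_space ?D ?E ..
  let ?F = "\<lambda>(y, z). f (g y) z"
  have F [measurable]: "?F \<in> borel_measurable (L \<Otimes>\<^sub>M N)"
    unfolding case_prod_beta
    by (rule measurable_compose_countable[where f = "\<lambda>c p. f c (snd p)"]) measurable
  have E: "(LINT z|?E. f c z) = (LINT \<omega>|M. f c (Z \<omega>))" for c
    by (rule integral_distr) auto
  have "integrable (?D \<Otimes>\<^sub>M ?E) ?F"
    using C by (intro DE.integrable_const_bound[of _ C]) auto
  then have "(LINT y|?D. LINT z|?E. ?F (y, z)) = integral\<^sup>L (?D \<Otimes>\<^sub>M ?E) ?F"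
    by (rule DE.integral_fst')
  also have "\<dots> = (LINT \<omega>|M. f (g (Y \<omega>)) (Z \<omega>))"
    unfolding eq by (subst integral_distr) auto
  also have "(LINT y|?D. LINT z|?E. ?F (y, z)) = (LINT \<omega>|M. LINT \<omega>'|M. f (g (Y \<omega>)) (Z \<omega>'))"
    by (subst integral_distr) (auto simp: E intro!: measurable_compose[OF g])
  finally show ?thesis ..
qed

section \<open>The iterated process\<close>

locale iterated_gcp = prob_space P for P :: "'a measure" +
  fixes M0 M :: "real \<Rightarrow> 'a \<Rightarrow> nat" and k0 k :: nat and \<mu> lam :: "nat \<Rightarrow> real"
  assumes outer: "gcp P k lam M" and inner: "gcp P k0 \<mu> M0"
    and indep: "independent_processes P M0 M"
begin

abbreviation X :: "real \<Rightarrow> 'a \<Rightarrow> real" where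
  "X t \<omega> \<equiv> real (igcp M0 M t \<omega>)"

text \<open>By stationarity this is also the law of the increment of \<open>M\<close> over any
  interval of length \<open>d\<close> with integer endpoints.\<close>

definition outer_law :: "real set \<Rightarrow> nat \<Rightarrow> real" where
  "outer_law A d = prob {\<omega> \<in> space P. real (M (real d) \<omega>) \<in> A}"

lemma measurable_M0: "0 \<le> t \<Longrightarrow> M0 t \<in> measurable P (count_space UNIV)"
  by (rule gcp_measurable[OF inner])

lemma measurable_M_nat: "M (real n) \<in> measurable P (count_space UNIV)"
  by (rule gcp_measurable[OF outer]) simp

text \<open>\<open>M0 t\<close> takes countably many values, and on each level set the composition
  is a fixed measurable \<open>M (real n)\<close>.\<close>

lemma measurable_igcp:
  assumes "0 \<le> t"
  shows "igcp M0 M t \<in> measurable P (count_space UNIV)"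
  unfolding igcp_def[abs_def]
  by (rule measurable_compose_countable[OF measurable_M_nat measurable_M0[OF assms]])

section \<open>Finite-dimensional laws given the inner process\<close>

text \<open>This freezes \<open>M0\<close>. Its values at finitely many times form a list, an
  element of a countable type, and depend measurably on its path; the path of \<open>M\<close> is
  the independent second variable.\<close>

lemma conditioning:
  fixes f :: "nat list \<Rightarrow> (real \<Rightarrow> nat) \<Rightarrow> 'e::{banach, second_countable_topology}"
  assumes ts: "\<And>t. t \<in> set ts \<Longrightarrow> 0 \<le> t"
    and f: "\<And>m. f m \<in> borel_measurable (PiM {0..} (\<lambda>_. count_space UNIV))"
    and C: "\<And>m z. norm (f m z) \<le> C"
  shows "(LINT \<omega>|P. f (map (\<lambda>t. M0 t \<omega>) ts) (\<lambda>t\<in>{0..}. M t \<omega>)) =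
    (LINT \<omega>|P. LINT \<omega>'|P. f (map (\<lambda>t. M0 t \<omega>) ts) (\<lambda>t\<in>{0..}. M t \<omega>'))"
proof -
  have g: "(\<lambda>z. map z ts) \<in> measurable (PiM {0..} (\<lambda>_. count_space UNIV)) (count_space (UNIV :: nat list set))"
    using ts
  proof (induction ts)
    case (Cons t ts)
    have [measurable]: "(\<lambda>z. z t) \<in> measurable (PiM {0..} (\<lambda>_. count_space UNIV)) (count_space (UNIV :: nat set))"
      using Cons.prems by (intro measurable_component_singleton) auto
    have [measurable]: "(\<lambda>z. map z ts) \<in> measurable (PiM {0..} (\<lambda>_. count_space UNIV)) (count_space (UNIV :: nat list set))"
      using Cons by auto
    show ?case by simp
  qed simp
  have "map (\<lambda>t\<in>{0..}. M0 t \<omega>) ts = map (\<lambda>t. M0 t \<omega>) ts" for \<omega>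
    using ts by (intro map_cong) auto
  then show ?thesis
    using indep_var_expectation_Fubini[OF indep[unfolded independent_processes_def] g, of f C] f C
    by (simp only: refl simp_thms)
qed

text \<open>At deterministic integer times the increments of \<open>M\<close> are independent, and
  by stationarity the law of each depends only on the length of its block. Times may repeat because
  \<open>M0\<close> may stay constant.\<close>

lemma prob_outer_increments:
  assumes m: "mono_on {..n} m" and A: "\<And>i. i < n \<Longrightarrow> A i \<in> sets borel"
  shows "(LINT \<omega>|P. (\<Prod>i<n. indicator (A i) (real (M (real (m (Suc i))) \<omega>) - real (M (real (m i)) \<omega>))) :: real) =
    (\<Prod>i<n. outer_law (A i) (m (Suc i) - m i))"
proof -
  let ?D = "\<lambda>i \<omega>. real (M (real (m (Suc i))) \<omega>) - real (M (real (m i)) \<omega>)"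
  have "indep_vars (\<lambda>_. borel) ?D {..<n}"
    using outer m by (intro indep_vars_increments_nat[of "\<lambda>t \<omega>. real (M t \<omega>)"]) (auto simp: gcp_def)
  then have ind: "indep_vars (\<lambda>_. borel) (\<lambda>i \<omega>. indicator (A i) (?D i \<omega>) :: real) {..<n}"
    by (rule indep_vars_compose2) (auto intro!: borel_measurable_indicator A)
  have "(LINT \<omega>|P. (\<Prod>i<n. indicator (A i) (?D i \<omega>)) :: real) = (\<Prod>i<n. (LINT \<omega>|P. indicator (A i) (?D i \<omega>)))"
  proof (rule indep_vars_lebesgue_integral[OF _ ind])
    show "integrable P (\<lambda>\<omega>. indicator (A i) (?D i \<omega>) :: real)" if "i \<in> {..<n}" for i
    proof -
      note [measurable] = measurable_M_nat[of "m i"] measurable_M_nat[of "m (Suc i)"]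
      have [measurable]: "A i \<in> sets borel" using that A by simp
      show ?thesis by (intro integrable_const_bound[of _ 1]) (auto simp: indicator_def)
    qed
  qed simp
  also have "\<dots> = (\<Prod>i<n. outer_law (A i) (m (Suc i) - m i))"
  proof (intro prod.cong refl)
    fix i assume "i \<in> {..<n}"
    then have le: "m i \<le> m (Suc i)" and [measurable]: "A i \<in> sets borel"
      using m A by (auto simp: mono_on_def)
    note [measurable] = measurable_M_nat[of "m i"] measurable_M_nat[of "m (Suc i)"]
      measurable_M_nat[of "m (Suc i) - m i"]
    have eq: "distr P borel (?D i) = distr P borel (\<lambda>\<omega>. real (M (real (m (Suc i) - m i)) \<omega>))"
      using outer le by (auto simp: gcp_def stationary_increments_def of_nat_diff)
    have "(LINT \<omega>|P. indicator (A i) (?D i \<omega>) :: real) = measure (distr P borel (?D i)) (A i)"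
      by (subst integral_distr[symmetric, of "?D i" _ borel]) auto
    also have "\<dots> = outer_law (A i) (m (Suc i) - m i)"
      unfolding eq outer_law_def by (subst measure_distr) (auto intro!: arg_cong[where f = prob])
    finally show "(LINT \<omega>|P. indicator (A i) (?D i \<omega>) :: real) = outer_law (A i) (m (Suc i) - m i)" .
  qed
  finally show ?thesis .
qed

text \<open>Once \<open>M0\<close> is frozen, the endpoints are almost surely increasing integers
  and the probability factorises. The form \<open>nat \<lfloor>_\<rfloor>\<close> of a real
  difference makes each factor a function of a real increment of \<open>M0\<close>, the quantity
  whose independence and stationarity are postulated.\<close>

lemma prob_increments:
  assumes \<tau>: "0 \<le> \<tau> 0" "mono_on {..n} \<tau>" and A: "\<And>i. i < n \<Longrightarrow> A i \<in> sets borel"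
  shows "prob {\<omega> \<in> space P. \<forall>i<n. X (\<tau> (Suc i)) \<omega> - X (\<tau> i) \<omega> \<in> A i} =
    (LINT \<omega>|P. (\<Prod>i<n. outer_law (A i) (nat \<lfloor>real (M0 (\<tau> (Suc i)) \<omega>) - real (M0 (\<tau> i) \<omega>)\<rfloor>)))"
proof -
  let ?ts = "map \<tau> [0..<Suc n]"
  let ?f = "\<lambda>(m :: nat list) z. \<Prod>i<n. indicator (A i) (real (z (real (m ! Suc i))) - real (z (real (m ! i)) :: nat)) :: real"
  have nn: "0 \<le> \<tau> i" if "i \<le> n" for i
    using \<tau> that mono_onD[OF \<tau>(2), of 0 i] by auto
  have le: "\<tau> i \<le> \<tau> (Suc i)" if "i < n" for i
    using that by (intro mono_onD[OF \<tau>(2)]) auto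
  define S where "S = {\<omega> \<in> space P. \<forall>i\<in>{..<n}. X (\<tau> (Suc i)) \<omega> - X (\<tau> i) \<omega> \<in> A i}"
  have S [measurable]: "S \<in> events"
    unfolding S_def
  proof (intro sets.sets_Collect_finite_All)
    fix i assume "i \<in> {..<n}"
    then have [measurable]: "A i \<in> sets borel" "igcp M0 M (\<tau> i) \<in> measurable P (count_space UNIV)"
        "igcp M0 M (\<tau> (Suc i)) \<in> measurable P (count_space UNIV)"
      using A nn by (auto intro!: measurable_igcp)
    show "{\<omega> \<in> space P. X (\<tau> (Suc i)) \<omega> - X (\<tau> i) \<omega> \<in> A i} \<in> events" by measurable
  qed simp
  have nth: "map (\<lambda>t. M0 t \<omega>) ?ts ! i = M0 (\<tau> i) \<omega>" if "i \<le> n" for i \<omega>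
    using that by (simp del: upt_Suc)
  have "prob {\<omega> \<in> space P. \<forall>i<n. X (\<tau> (Suc i)) \<omega> - X (\<tau> i) \<omega> \<in> A i} = prob S"
    by (simp only: S_def Ball_def lessThan_iff)
  also have "\<dots> = (LINT \<omega>|P. indicator S \<omega>)"
    by simp
  also have "\<dots> = (LINT \<omega>|P. (\<Prod>i<n. indicator (A i) (X (\<tau> (Suc i)) \<omega> - X (\<tau> i) \<omega>)))"
  proof (intro Bochner_Integration.integral_cong refl)
    fix \<omega> assume "\<omega> \<in> space P"
    then show "indicator S \<omega> = (\<Prod>i<n. indicator (A i) (X (\<tau> (Suc i)) \<omega> - X (\<tau> i) \<omega>) :: real)"
      by (cases "\<omega> \<in> S") (auto simp: S_def indicator_eq_0_iff intro!: prod.neutral[symmetric] prod_zero[symmetric])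
  qed
  also have "\<dots> = (LINT \<omega>|P. ?f (map (\<lambda>t. M0 t \<omega>) ?ts) (\<lambda>t\<in>{0..}. M t \<omega>))"
    by (intro Bochner_Integration.integral_cong prod.cong refl)
       (simp add: nth igcp_def del: upt_Suc)
  also have "\<dots> = (LINT \<omega>|P. LINT \<omega>'|P. ?f (map (\<lambda>t. M0 t \<omega>) ?ts) (\<lambda>t\<in>{0..}. M t \<omega>'))"
  proof (rule conditioning)
    show "0 \<le> t" if "t \<in> set ?ts" for t
      using nn that by (auto simp del: upt_Suc)
    show "?f m \<in> borel_measurable (PiM {0..} (\<lambda>_. count_space UNIV))" for m
    proof (intro borel_measurable_prod)
      fix i assume "i \<in> {..<n}"
      then have [measurable]: "A i \<in> sets borel" using A by simp
      have [measurable]: "(\<lambda>z. z (real j)) \<in> measurable (PiM {0..} (\<lambda>_. count_space UNIV)) (count_space (UNIV :: nat set))" for j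
        by (intro measurable_component_singleton) auto
      show "(\<lambda>z. indicator (A i) (real (z (real (m ! Suc i))) - real (z (real (m ! i)) :: nat)) :: real)
          \<in> borel_measurable (PiM {0..} (\<lambda>_. count_space UNIV))"
        by measurable
    qed
    show "norm (?f m z) \<le> 1" for m z
      by (auto simp: abs_prod indicator_def intro!: prod_le_1)
  qed
  also have "\<dots> = (LINT \<omega>|P. LINT \<omega>'|P.
      (\<Prod>i<n. indicator (A i) (real (M (real (M0 (\<tau> (Suc i)) \<omega>)) \<omega>') - real (M (real (M0 (\<tau> i) \<omega>)) \<omega>'))))"
    by (intro Bochner_Integration.integral_cong prod.cong refl)
       (simp add: nth del: upt_Suc)
  \<comment> \<open>The integrands agree only almost everywhere, because \<open>M0\<close> is
    monotone along the times \<open>\<tau> i\<close> only outside a null set.\<close>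
  also have "\<dots> = (LINT \<omega>|P. (\<Prod>i<n. outer_law (A i) (nat \<lfloor>real (M0 (\<tau> (Suc i)) \<omega>) - real (M0 (\<tau> i) \<omega>)\<rfloor>)))"
  proof (rule integral_cong_AE)
    have "AE \<omega> in P. \<forall>i\<in>{..<n}. M0 (\<tau> i) \<omega> \<le> M0 (\<tau> (Suc i)) \<omega>"
      using nn le by (intro AE_finite_allI gcp_mono_AE[OF inner]) auto
    then have "AE \<omega> in P. \<forall>i<n. M0 (\<tau> i) \<omega> \<le> M0 (\<tau> (Suc i)) \<omega>"
      by (rule eventually_mono) auto
    then show "AE \<omega> in P. (LINT \<omega>'|P.
      (\<Prod>i<n. indicator (A i) (real (M (real (M0 (\<tau> (Suc i)) \<omega>)) \<omega>') - real (M (real (M0 (\<tau> i) \<omega>)) \<omega>')))) =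
      (\<Prod>i<n. outer_law (A i) (nat \<lfloor>real (M0 (\<tau> (Suc i)) \<omega>) - real (M0 (\<tau> i) \<omega>)\<rfloor>))"
    proof eventually_elim
      case (elim \<omega>)
      have "mono_on {..n} (\<lambda>i. M0 (\<tau> i) \<omega>)"
      proof (rule mono_onI)
        fix i j assume "i \<in> {..n}" "j \<in> {..n}" "i \<le> j"
        from \<open>i \<le> j\<close> \<open>j \<in> {..n}\<close> show "M0 (\<tau> i) \<omega> \<le> M0 (\<tau> j) \<omega>"
        proof (induction j rule: dec_induct)
          case (step j)
          then show ?case using elim[rule_format, of j] by auto
        qed simp
      qed
      from prob_outer_increments[OF this A] have "(LINT \<omega>'|P.
        (\<Prod>i<n. indicator (A i) (real (M (real (M0 (\<tau> (Suc i)) \<omega>)) \<omega>') - real (M (real (M0 (\<tau> i) \<omega>)) \<omega>'))) :: real) =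
        (\<Prod>i<n. outer_law (A i) (M0 (\<tau> (Suc i)) \<omega> - M0 (\<tau> i) \<omega>))" by simp
      \<comment> \<open>Monotonicity ensures that the subtraction on \<open>nat\<close> does not
        truncate.\<close>
      also have "\<dots> = (\<Prod>i<n. outer_law (A i) (nat \<lfloor>real (M0 (\<tau> (Suc i)) \<omega>) - real (M0 (\<tau> i) \<omega>)\<rfloor>))"
        using elim by (intro prod.cong refl) (simp flip: of_nat_diff)
      finally show ?case .
    qed
    show "(\<lambda>\<omega>. \<Prod>i<n. outer_law (A i) (nat \<lfloor>real (M0 (\<tau> (Suc i)) \<omega>) - real (M0 (\<tau> i) \<omega>)\<rfloor>)) \<in> borel_measurable P"
    proof (intro borel_measurable_prod)
      fix i assume i: "i \<in> {..<n}"
      have [measurable]: "M0 (\<tau> i) \<in> measurable P (count_space UNIV)" "M0 (\<tau> (Suc i)) \<in> measurable P (count_space UNIV)"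
        using nn i by (auto intro!: measurable_M0)
      show "(\<lambda>\<omega>. outer_law (A i) (nat \<lfloor>real (M0 (\<tau> (Suc i)) \<omega>) - real (M0 (\<tau> i) \<omega>)\<rfloor>)) \<in> borel_measurable P"
        by measurable
    qed
    \<comment> \<open>The inner integral is a function \<open>?H\<close> of this list; every
      function on a discrete space is measurable, so only the list itself has to be treated.\<close>
    have vals: "(\<lambda>\<omega>. map (\<lambda>t. M0 t \<omega>) ?ts) \<in> measurable P (count_space UNIV)"
    proof -
      have "(\<lambda>\<omega>. map (\<lambda>t. M0 t \<omega>) ts) \<in> measurable P (count_space UNIV)" if "set ts \<subseteq> {0..}" for ts
        using that
      proof (induction ts)
        case (Cons t ts)
        then have [measurable]: "M0 t \<in> measurable P (count_space UNIV)"
            "(\<lambda>\<omega>. map (\<lambda>t. M0 t \<omega>) ts) \<in> measurable P (count_space UNIV)"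
          by (auto intro!: measurable_M0)
        show ?case by simp
      qed simp
      then show ?thesis using nn by (simp add: image_subset_iff del: upt_Suc map_map)
    qed
    let ?H = "\<lambda>m. LINT \<omega>'|P. (\<Prod>i<n. indicator (A i) (real (M (real (m ! Suc i)) \<omega>') - real (M (real (m ! i)) \<omega>'))) :: real"
    have "(\<lambda>\<omega>. ?H (map (\<lambda>t. M0 t \<omega>) ?ts)) \<in> borel_measurable P"
      by (rule measurable_compose[OF vals, of ?H borel]) simp
    moreover have "?H (map (\<lambda>t. M0 t \<omega>) ?ts) = (LINT \<omega>'|P.
      (\<Prod>i<n. indicator (A i) (real (M (real (M0 (\<tau> (Suc i)) \<omega>)) \<omega>') - real (M (real (M0 (\<tau> i) \<omega>)) \<omega>'))))" for \<omega>
      by (intro Bochner_Integration.integral_cong prod.cong refl) (simp add: nth del: upt_Suc map_map)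
    ultimately show "(\<lambda>\<omega>. LINT \<omega>'|P.
      (\<Prod>i<n. indicator (A i) (real (M (real (M0 (\<tau> (Suc i)) \<omega>)) \<omega>') - real (M (real (M0 (\<tau> i) \<omega>)) \<omega>'))) :: real)
      \<in> borel_measurable P"
      by (simp only:)
  qed
  finally show ?thesis .
qed

section \<open>The Levy property of the composition\<close>

lemma measurable_X: "0 \<le> t \<Longrightarrow> X t \<in> borel_measurable P"
  using measurable_igcp by measurable

lemma M0_start: "AE \<omega> in P. M0 0 \<omega> = 0"
  using inner by (simp add: gcp_def)

lemma igcp_start: "AE \<omega> in P. igcp M0 M 0 \<omega> = 0"
proof -
  have "AE \<omega> in P. M 0 \<omega> = 0"
    using outer by (simp add: gcp_def)
  with M0_start show ?thesis
    by eventually_elim (simp add: igcp_def)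
qed

lemma prob_increment:
  assumes st: "0 \<le> s" "s \<le> t" and A: "A \<in> sets borel"
  shows "prob {\<omega> \<in> space P. X t \<omega> - X s \<omega> \<in> A} =
    (LINT \<omega>|P. outer_law A (nat \<lfloor>real (M0 t \<omega>) - real (M0 s \<omega>)\<rfloor>))"
proof -
  \<comment> \<open>A partition with the single interval from \<open>s\<close> to
    \<open>t\<close>.\<close>
  let ?\<tau> = "\<lambda>i::nat. if i = 0 then s else t"
  have "mono_on {..1} ?\<tau>" using st by (auto simp: mono_on_def)
  from prob_increments[of ?\<tau>, OF _ this, of "\<lambda>_. A"] show ?thesis
    using st A by simp
qed

lemma prob_value:
  assumes t: "0 \<le> t" and [measurable]: "A \<in> sets borel"
  shows "prob {\<omega> \<in> space P. X t \<omega> \<in> A} = (LINT \<omega>|P. outer_law A (M0 t \<omega>))"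
proof -
  have [measurable]: "igcp M0 M t \<in> measurable P (count_space UNIV)" "M0 t \<in> measurable P (count_space UNIV)"
    "igcp M0 M 0 \<in> measurable P (count_space UNIV)" "M0 0 \<in> measurable P (count_space UNIV)"
    using t by (auto intro!: measurable_igcp measurable_M0)
  have "prob {\<omega> \<in> space P. X t \<omega> \<in> A} = prob {\<omega> \<in> space P. X t \<omega> - X 0 \<omega> \<in> A}"
    using igcp_start by (intro finite_measure_eq_AE) (auto elim!: eventually_mono)
  also have "\<dots> = (LINT \<omega>|P. outer_law A (nat \<lfloor>real (M0 t \<omega>) - real (M0 0 \<omega>)\<rfloor>))"
    using t by (intro prob_increment) auto
  also have "\<dots> = (LINT \<omega>|P. outer_law A (M0 t \<omega>))"
    using M0_start by (intro integral_cong_AE) (auto elim!: eventually_mono)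
  finally show ?thesis .
qed

text \<open>Both laws integrate the same function \<open>outer_law A\<close>, once against the law
  of an increment of \<open>M0\<close> and once against that of \<open>M0 (t - s)\<close>; these two
  laws coincide.\<close>

lemma stationary_increments_igcp: "stationary_increments P X"
  unfolding stationary_increments_def
proof (intro allI impI)
  fix s t :: real assume "0 \<le> s \<and> s \<le> t"
  then have st: "0 \<le> s" "s \<le> t" "0 \<le> t" "0 \<le> t - s" by auto
  note [measurable] = measurable_igcp[OF st(1)] measurable_igcp[OF st(3)] measurable_igcp[OF st(4)]
    measurable_M0[OF st(1)] measurable_M0[OF st(3)] measurable_M0[OF st(4)]
  have eq: "distr P borel (\<lambda>\<omega>. real (M0 t \<omega>) - real (M0 s \<omega>)) = distr P borel (\<lambda>\<omega>. real (M0 (t - s) \<omega>))"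
    using inner st by (auto simp: gcp_def stationary_increments_def)
  show "distr P borel (\<lambda>\<omega>. X t \<omega> - X s \<omega>) = distr P borel (X (t - s))"
  proof (rule measure_eqI)
    fix A :: "real set" assume "A \<in> sets (distr P borel (\<lambda>\<omega>. X t \<omega> - X s \<omega>))"
    then have A [measurable]: "A \<in> sets borel" by simp
    have "prob {\<omega> \<in> space P. X t \<omega> - X s \<omega> \<in> A} =
        (LINT x|distr P borel (\<lambda>\<omega>. real (M0 t \<omega>) - real (M0 s \<omega>)). outer_law A (nat \<lfloor>x\<rfloor>))"
      unfolding prob_increment[OF st(1,2) A] by (subst integral_distr) auto
    also have "\<dots> = prob {\<omega> \<in> space P. X (t - s) \<omega> \<in> A}"
      unfolding eq prob_value[OF st(4) A] by (subst integral_distr) auto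
    finally have "prob ((\<lambda>\<omega>. X t \<omega> - X s \<omega>) -` A \<inter> space P) = prob (X (t - s) -` A \<inter> space P)"
      by (simp add: vimage_def Int_def conj_commute)
    then show "emeasure (distr P borel (\<lambda>\<omega>. X t \<omega> - X s \<omega>)) A = emeasure (distr P borel (X (t - s))) A"
      by (simp add: emeasure_distr emeasure_eq_measure)
  qed simp
qed

text \<open>A joint probability is the expectation of a product of functions of single increments of
  \<open>M0\<close>. These are independent, so the expectation factorises, and each factor is the
  probability for one increment of \<open>X\<close>.\<close>

lemma independent_increments_igcp: "independent_increments P X"
  unfolding independent_increments_def
proof (intro allI impI)
  fix n and \<tau> :: "nat \<Rightarrow> real" assume \<tau>: "0 \<le> \<tau> 0 \<and> strict_mono_on {..n} \<tau>"
  then have mono: "mono_on {..n} \<tau>"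
    by (intro strict_mono_on_imp_mono_on) auto
  have nn: "0 \<le> \<tau> i" if "i \<le> n" for i
    using \<tau> that mono_onD[OF mono, of 0 i] by auto
  let ?D = "\<lambda>i \<omega>. X (\<tau> (Suc i)) \<omega> - X (\<tau> i) \<omega>"
  let ?E = "\<lambda>i \<omega>. real (M0 (\<tau> (Suc i)) \<omega>) - real (M0 (\<tau> i) \<omega>)"
  show "indep_vars (\<lambda>_. borel) ?D {..<n}"
  \<comment> \<open>The empty family is separated because the criterion by product events intersects
    over a nonempty index set.\<close>
  proof (cases "n = 0")
    case True
    then show ?thesis by (simp add: indep_vars_def indep_sets_def)
  next
    case False
    have "?D i \<in> borel_measurable P" if "i \<in> {..<n}" for i
    proof -
      have "0 \<le> \<tau> i" "0 \<le> \<tau> (Suc i)" using nn that by auto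
      then show ?thesis by (intro borel_measurable_diff measurable_X)
    qed
    moreover have "prob (\<Inter>i\<in>{..<n}. ?D i -` A i \<inter> space P) = (\<Prod>i<n. prob (?D i -` A i \<inter> space P))"
      if "A \<in> (\<Pi> i\<in>{..<n}. sets borel)" for A
    proof -
      have A: "A i \<in> sets borel" if "i < n" for i
        using \<open>A \<in> _\<close> that by auto
      have "indep_vars (\<lambda>_. borel) ?E {..<n}"
        using inner \<tau> by (simp add: gcp_def independent_increments_def)
      then have ind: "indep_vars (\<lambda>_. borel) (\<lambda>i \<omega>. outer_law (A i) (nat \<lfloor>?E i \<omega>\<rfloor>)) {..<n}"
        by (rule indep_vars_compose2) measurable
      have "(\<Inter>i\<in>{..<n}. ?D i -` A i \<inter> space P) = {\<omega> \<in> space P. \<forall>i<n. ?D i \<omega> \<in> A i}"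
        using False by auto
      then have "prob (\<Inter>i\<in>{..<n}. ?D i -` A i \<inter> space P) = (LINT \<omega>|P. (\<Prod>i<n. outer_law (A i) (nat \<lfloor>?E i \<omega>\<rfloor>)))"
        using prob_increments[of \<tau> n A] \<tau> mono A by simp
      also have "\<dots> = (\<Prod>i<n. LINT \<omega>|P. outer_law (A i) (nat \<lfloor>?E i \<omega>\<rfloor>))"
      proof (rule indep_vars_lebesgue_integral[OF _ ind])
        fix i assume "i \<in> {..<n}"
        with ind have "(\<lambda>\<omega>. outer_law (A i) (nat \<lfloor>?E i \<omega>\<rfloor>)) \<in> borel_measurable P"
          by (auto simp: indep_vars_def)
        then show "integrable P (\<lambda>\<omega>. outer_law (A i) (nat \<lfloor>?E i \<omega>\<rfloor>))"
          by (intro integrable_const_bound[of _ 1]) (auto simp: outer_law_def)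
      qed simp
      also have "\<dots> = (\<Prod>i<n. prob (?D i -` A i \<inter> space P))"
      proof (intro prod.cong refl)
        fix i assume i: "i \<in> {..<n}"
        have "?D i -` A i \<inter> space P = {\<omega> \<in> space P. ?D i \<omega> \<in> A i}" by auto
        then show "(LINT \<omega>|P. outer_law (A i) (nat \<lfloor>?E i \<omega>\<rfloor>)) = prob (?D i -` A i \<inter> space P)"
          using i nn A mono_onD[OF mono, of i "Suc i"] by (simp add: prob_increment)
      qed
      finally show ?thesis .
    qed
    ultimately show ?thesis
      using False
      by (subst indep_vars_finite[where E = "\<lambda>_. sets borel"])
         (auto simp: sets.sigma_sets_eq[of borel, simplified] sets.Int_stable)
  qed
qed

text \<open>\<open>X\<close> can differ at two times only if \<open>M0\<close> does, which has
  probability \<open>1 - exp (- \<bar>t - s\<bar> * c)\<close>, where \<open>c\<close> is the total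
  rate of \<open>M0\<close>.\<close>

lemma stochastically_continuous_igcp: "stochastically_continuous P X"
  unfolding stochastically_continuous_def
proof (intro allI impI)
  fix s \<epsilon> :: real assume s: "0 \<le> s" and \<epsilon>: "0 < \<epsilon>"
  let ?c = "\<Sum>j=1..k0. \<mu> j"
  have le: "prob {\<omega> \<in> space P. \<epsilon> < \<bar>X t \<omega> - X s \<omega>\<bar>} \<le> 1 - exp (- \<bar>t - s\<bar> * ?c)" if t: "0 \<le> t" for t
  proof -
    note [measurable] = measurable_M0[OF s] measurable_M0[OF t]
    have "{\<omega> \<in> space P. real (M0 t \<omega>) = real (M0 s \<omega>)} \<in> events"
      using s t by (intro borel_measurable_eq measurable_compose[OF measurable_M0]) auto
    then have [simp]: "{\<omega> \<in> space P. M0 t \<omega> = M0 s \<omega>} \<in> events" by simp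
    have "prob {\<omega> \<in> space P. \<epsilon> < \<bar>X t \<omega> - X s \<omega>\<bar>} \<le> prob (space P - {\<omega> \<in> space P. M0 t \<omega> = M0 s \<omega>})"
      using \<epsilon> by (intro finite_measure_mono) (auto simp: igcp_def intro!: sets.Diff)
    also have "\<dots> = 1 - prob {\<omega> \<in> space P. M0 t \<omega> = M0 s \<omega>}"
      by (rule prob_compl) simp
    finally show ?thesis
      by (simp add: gcp_prob_increment_zero[OF inner s t])
  qed
  have "((\<lambda>t. 1 - exp (- \<bar>t - s\<bar> * ?c)) \<longlongrightarrow> 1 - exp (- \<bar>s - s\<bar> * ?c)) (at s within {0..})"
    by (intro tendsto_intros)
  then have lim: "((\<lambda>t. 1 - exp (- \<bar>t - s\<bar> * ?c)) \<longlongrightarrow> 0) (at s within {0..})" by simp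
  show "((\<lambda>t. prob {\<omega> \<in> space P. \<epsilon> < \<bar>X t \<omega> - X s \<omega>\<bar>}) \<longlongrightarrow> 0) (at s within {0..})"
  proof (rule tendsto_sandwich[OF _ _ tendsto_const lim])
    have "\<forall>\<^sub>F t in at s within {0..}. 0 \<le> t" by (simp add: eventually_at_filter)
    then show "\<forall>\<^sub>F t in at s within {0..}. prob {\<omega> \<in> space P. \<epsilon> < \<bar>X t \<omega> - X s \<omega>\<bar>} \<le> 1 - exp (- \<bar>t - s\<bar> * ?c)"
      by (rule eventually_mono) (rule le)
  qed simp
qed

lemma levy_process_igcp: "levy_process P X"
  unfolding levy_process_def
proof (intro conjI allI impI)
  show "X t \<in> borel_measurable P" if "0 \<le> t" for t
    using that by (rule measurable_X)
  show "AE \<omega> in P. X 0 \<omega> = 0"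
    using igcp_start by simp
qed (rule prob_space_axioms independent_increments_igcp stationary_increments_igcp
  stochastically_continuous_igcp)+

section \<open>Characteristic function of the composition\<close>

lemma outer_pgf:
  fixes u :: complex
  assumes "norm u \<le> 1"
  shows "(CLINT \<omega>|P. u ^ M (real d) \<omega>) = exp (- (\<Sum>j=1..k. of_real (lam j) * (1 - u ^ j))) ^ d"
proof -
  have "(CLINT \<omega>|P. u ^ M (real d) \<omega>) = exp (- of_real (real d) * (\<Sum>j=1..k. of_real (lam j) * (1 - u ^ j)))"
    using assms by (intro gcp_pgf[OF outer]) auto
  then show ?thesis by (simp flip: exp_of_nat_mult)
qed

text \<open>\<open>v \<theta>\<close> is the generating function of \<open>M 1\<close> at
  \<open>iexp \<theta>\<close>. Freezing \<open>M0 t\<close> leaves the expectation of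
  \<open>v \<theta> ^ M0 t\<close>, which is the generating function of \<open>M0\<close> at
  \<open>v \<theta>\<close>.\<close>

lemma char_igcp:
  assumes t: "0 \<le> t"
  defines "v \<equiv> \<lambda>\<theta>. exp (- (\<Sum>j=1..k. of_real (lam j) * (1 - iexp \<theta> ^ j)))"
  shows "char (distr P borel (X t)) \<theta> = exp (- of_real t * (\<Sum>j=1..k0. of_real (\<mu> j) * (1 - v \<theta> ^ j)))"
proof -
  have iexp_nat: "iexp (\<theta> * real n) = iexp \<theta> ^ n" for n
    by (simp add: algebra_simps flip: exp_of_nat_mult)
  \<comment> \<open>As the expectation of a variable of modulus one, \<open>v \<theta>\<close> lies
    in the closed unit disc and is an admissible argument of the generating function of
    \<open>M0\<close>.\<close>
  have "norm (CLINT \<omega>|P. iexp \<theta> ^ M (real 1) \<omega>) \<le> (LINT \<omega>|P. norm (iexp \<theta> ^ M (real 1) \<omega>))"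
    by (rule integral_norm_bound)
  then have v: "norm (v \<theta>) \<le> 1"
    unfolding v_def by (subst (asm) outer_pgf) (auto simp: norm_power prob_space)
  note [measurable] = measurable_igcp[OF t]
  have "char (distr P borel (X t)) \<theta> = (CLINT \<omega>|P. iexp (\<theta> * real (igcp M0 M t \<omega>)))"
    unfolding char_def by (subst integral_distr) auto
  \<comment> \<open>Only the value of \<open>M0\<close> at \<open>t\<close> is frozen;
    \<open>hd\<close> reads it off the one-element list.\<close>
  also have "\<dots> = (CLINT \<omega>|P. (\<lambda>m z. iexp \<theta> ^ z (real (hd m)) ) (map (\<lambda>t. M0 t \<omega>) [t]) (\<lambda>t\<in>{0..}. M t \<omega>))"
    unfolding iexp_nat using t by (simp add: igcp_def)
  also have "\<dots> = (CLINT \<omega>|P. CLINT \<omega>'|P. (\<lambda>m z. iexp \<theta> ^ z (real (hd m)) ) (map (\<lambda>t. M0 t \<omega>) [t]) (\<lambda>t\<in>{0..}. M t \<omega>'))"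
  proof (rule conditioning[where C = 1])
    fix m :: "nat list"
    have [measurable]: "(\<lambda>z. z (real (hd m))) \<in> measurable (PiM {0..} (\<lambda>_. count_space UNIV)) (count_space (UNIV :: nat set))"
      by (intro measurable_component_singleton) auto
    show "(\<lambda>z. iexp \<theta> ^ z (real (hd m))) \<in> borel_measurable (PiM {0..} (\<lambda>_. count_space UNIV))"
      by measurable
  qed (use t in \<open>auto simp: norm_power\<close>)
  also have "\<dots> = (CLINT \<omega>|P. v \<theta> ^ M0 t \<omega>)"
    by (simp add: outer_pgf v_def)
  also have "\<dots> = exp (- of_real t * (\<Sum>j=1..k0. of_real (\<mu> j) * (1 - v \<theta> ^ j)))"
    by (rule gcp_pgf[OF inner t v])
  finally show ?thesis .
qed

end

section \<open>Weighted Poisson sums\<close>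

text \<open>
  The default value \<open>undefined\<close> makes the product distribution live on extensional functions,
  as \<open>Omega\<close> requires.
\<close>

definition jump_pmf :: "nat \<Rightarrow> (nat \<Rightarrow> real) \<Rightarrow> nat pmf" where
  "jump_pmf k a = map_pmf (\<lambda>\<nu>. \<Sum>j=1..k. j * \<nu> j) (Pi_pmf {1..k} undefined (\<lambda>j. poisson_pmf (a j)))"

lemma pmf_jump_pmf:
  assumes a: "\<And>j. j \<in> {1..k} \<Longrightarrow> 0 < a j"
  shows "pmf (jump_pmf k a) n = (\<Sum>\<nu>\<in>Omega k n. \<Prod>j=1..k. a j ^ \<nu> j / fact (\<nu> j) * exp (- a j))"
proof -
  let ?p = "Pi_pmf {1..k} undefined (\<lambda>j. poisson_pmf (a j))"
  have "pmf (jump_pmf k a) n = measure ?p ((\<lambda>\<nu>. \<Sum>j=1..k. j * \<nu> j) -` {n})"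
    by (simp add: jump_pmf_def pmf_map)
  \<comment> \<open>The preimage also contains functions that are not \<open>undefined\<close>
    outside \<open>{1..k}\<close>, but these have probability zero.\<close>
  also have "\<dots> = measure ?p (Omega k n)"
    by (intro measure_prob_cong_0) (auto simp: Omega_def pmf_Pi PiE_iff extensional_def)
  also have "\<dots> = (\<Sum>\<nu>\<in>Omega k n. pmf ?p \<nu>)"
    by (rule measure_measure_pmf_finite[OF finite_Omega])
  also have "\<dots> = (\<Sum>\<nu>\<in>Omega k n. \<Prod>j=1..k. a j ^ \<nu> j / fact (\<nu> j) * exp (- a j))"
  proof (intro sum.cong refl)
    fix \<nu> assume "\<nu> \<in> Omega k n"
    then have "pmf ?p \<nu> = (\<Prod>j=1..k. pmf (poisson_pmf (a j)) (\<nu> j))"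
      by (intro pmf_Pi') (auto simp: Omega_def PiE_iff extensional_def)
    also have "\<dots> = (\<Prod>j=1..k. a j ^ \<nu> j / fact (\<nu> j) * exp (- a j))"
      by (intro prod.cong refl pmf_poisson a)
    finally show "pmf ?p \<nu> = \<dots>" .
  qed
  finally show ?thesis .
qed

text \<open>The integral against counting measure is a convergent series, which agrees term by term
  with \<open>exp (- r)\<close> times the exponential series of \<open>r * u\<close>.\<close>

lemma poisson_pmf_pgf:
  fixes u :: complex
  assumes r: "0 < r" and u: "norm u \<le> 1"
  shows "(LINT n|measure_pmf (poisson_pmf r). u ^ n) = exp (- of_real r * (1 - u))"
proof -
  have "integrable (measure_pmf (poisson_pmf r)) (\<lambda>n. u ^ n)"
    using u by (intro measure_pmf.integrable_const_bound[of _ 1]) (auto simp: norm_power power_le_one)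
  then have "integrable (count_space UNIV) (\<lambda>n. pmf (poisson_pmf r) n *\<^sub>R u ^ n)"
    unfolding measure_pmf_eq_density by (subst (asm) integrable_density) auto
  then have "(\<lambda>n. pmf (poisson_pmf r) n *\<^sub>R u ^ n) sums
      (LINT n|count_space UNIV. pmf (poisson_pmf r) n *\<^sub>R u ^ n)"
    by (rule sums_integral_count_space_nat)
  also have "(LINT n|count_space UNIV. pmf (poisson_pmf r) n *\<^sub>R u ^ n) = (LINT n|measure_pmf (poisson_pmf r). u ^ n)"
    unfolding measure_pmf_eq_density by (subst integral_density) auto
  finally have "(\<lambda>n. pmf (poisson_pmf r) n *\<^sub>R u ^ n) sums (LINT n|measure_pmf (poisson_pmf r). u ^ n)" .
  moreover have "(\<lambda>n. of_real (exp (- r)) * ((of_real r * u) ^ n /\<^sub>R fact n)) sums (of_real (exp (- r)) * exp (of_real r * u))"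
    by (intro sums_mult exp_converges)
  moreover have "of_real (exp (- r)) * ((of_real r * u) ^ n /\<^sub>R fact n) = pmf (poisson_pmf r) n *\<^sub>R u ^ n" for n
    using r by (simp add: scaleR_conv_of_real power_mult_distrib field_simps)
  moreover have "complex_of_real (exp (- r)) * exp (of_real r * u) = exp (- of_real r * (1 - u))"
    by (simp add: algebra_simps flip: exp_of_real exp_add)
  ultimately show ?thesis
    by (metis (no_types, lifting) ext sums_unique2)
qed

text \<open>\<open>u\<close> raised to the weighted sum is the product of the
  \<open>(u ^ j) ^ \<nu> j\<close>. The coordinates are independent, so each contributes its Poisson
  generating function at \<open>u ^ j\<close>.\<close>

lemma jump_pmf_pgf:
  fixes u :: complex
  assumes a: "\<And>j. j \<in> {1..k} \<Longrightarrow> 0 < a j" and u: "norm u \<le> 1"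
  shows "(LINT n|measure_pmf (jump_pmf k a). u ^ n) = exp (- (\<Sum>j=1..k. of_real (a j) * (1 - u ^ j)))"
proof -
  let ?p = "Pi_pmf {1..k} undefined (\<lambda>j. poisson_pmf (a j))"
  have uj: "norm (u ^ j) \<le> 1" for j
    using u by (simp add: norm_power power_le_one)
  have ind: "prob_space.indep_vars (measure_pmf ?p) (\<lambda>_. borel) (\<lambda>j \<nu>. (u ^ j) ^ \<nu> j) {1..k}"
    by (rule prob_space.indep_vars_compose2[OF measure_pmf.prob_space_axioms indep_vars_Pi_pmf]) auto
  have "(LINT n|measure_pmf (jump_pmf k a). u ^ n) = (LINT \<nu>|measure_pmf ?p. (\<Prod>j=1..k. (u ^ j) ^ \<nu> j))"
    by (simp add: jump_pmf_def power_sum power_mult)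
  also have "\<dots> = (\<Prod>j=1..k. LINT \<nu>|measure_pmf ?p. (u ^ j) ^ \<nu> j)"
    using uj by (intro prob_space.indep_vars_lebesgue_integral[OF measure_pmf.prob_space_axioms _ ind] measure_pmf.integrable_const_bound[of _ 1])
       (auto simp: norm_power power_le_one)
  also have "\<dots> = (\<Prod>j=1..k. exp (- of_real (a j) * (1 - u ^ j)))"
  proof (intro prod.cong refl)
    fix j assume j: "j \<in> {1..k}"
    have "(LINT \<nu>|measure_pmf ?p. (u ^ j) ^ \<nu> j) = (LINT n|measure_pmf (map_pmf (\<lambda>\<nu>. \<nu> j) ?p). (u ^ j) ^ n)"
      by simp
    also have "map_pmf (\<lambda>\<nu>. \<nu> j) ?p = poisson_pmf (a j)"
      using j by (subst Pi_pmf_component) auto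
    finally show "(LINT \<nu>|measure_pmf ?p. (u ^ j) ^ \<nu> j) = exp (- of_real (a j) * (1 - u ^ j))"
      using poisson_pmf_pgf[OF a[OF j] uj] by simp
  qed
  finally show ?thesis
    by (simp add: exp_sum sum_negf[symmetric] del: sum_negf)
qed

section \<open>Mixtures of integer laws without the atom at zero\<close>

text \<open>The indicator deletes the atom at \<open>0\<close>, which a Levy measure must not have.
  A density on \<open>nat\<close> pushed to the reals turns integrals into series.\<close>

definition pmf_mixture :: "'i set \<Rightarrow> ('i \<Rightarrow> real) \<Rightarrow> ('i \<Rightarrow> nat pmf) \<Rightarrow> real measure" where
  "pmf_mixture I c q = distr (density (count_space UNIV)
     (\<lambda>n. ennreal (indicator {0<..} n * (\<Sum>i\<in>I. c i * pmf (q i) n)))) borel real"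

lemma sets_pmf_mixture [measurable_cong, simp]: "sets (pmf_mixture I c q) = sets borel"
  by (simp add: pmf_mixture_def)

lemma emeasure_pmf_mixture:
  assumes c: "\<And>i. i \<in> I \<Longrightarrow> 0 \<le> c i" and A: "A \<in> sets borel"
  shows "emeasure (pmf_mixture I c q) A =
    (\<Sum>i\<in>I. ennreal (c i) * (\<Sum>n. ennreal (pmf (q i) (Suc n)) * emeasure (return borel (real (Suc n))) A))"
proof -
  let ?g = "\<lambda>n. ennreal (indicator {0<..} n * (\<Sum>i\<in>I. c i * pmf (q i) n))"
  have "emeasure (pmf_mixture I c q) A = (\<integral>\<^sup>+n. ?g n * indicator A (real n) \<partial>count_space UNIV)"
    using A unfolding pmf_mixture_def
    by (subst emeasure_distr) (auto simp: emeasure_density indicator_def intro!: nn_integral_cong)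
  also have "\<dots> = (\<Sum>n. ?g n * indicator A (real n))"
    by (rule nn_integral_count_space_nat)
  \<comment> \<open>The term at \<open>0\<close> vanishes by the indicator, so the series may start
    at \<open>1\<close>.\<close>
  also have "\<dots> = (\<Sum>n. ?g (Suc n) * indicator A (real (Suc n)))"
    by (subst suminf_offset[of _ 1]) (auto simp: indicator_def)
  also have "\<dots> = (\<Sum>n. \<Sum>i\<in>I. ennreal (c i) * (ennreal (pmf (q i) (Suc n)) * emeasure (return borel (real (Suc n))) A))"
    using c A by (intro suminf_cong)
      (simp add: sum_distrib_right ennreal_mult mult.assoc emeasure_return flip: sum_ennreal)
  also have "\<dots> = (\<Sum>i\<in>I. \<Sum>n. ennreal (c i) * (ennreal (pmf (q i) (Suc n)) * emeasure (return borel (real (Suc n))) A))"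
    by (rule suminf_sum) auto
  finally show ?thesis by simp
qed

text \<open>Each \<open>q i\<close> has mass at most one on the positive integers, so the total mass
  is at most the sum of the weights.\<close>

lemma finite_measure_pmf_mixture:
  assumes I: "finite I" and c: "\<And>i. i \<in> I \<Longrightarrow> 0 \<le> c i"
  shows "finite_measure (pmf_mixture I c q)"
proof (rule finite_measureI)
  have "(\<Sum>n. ennreal (pmf (q i) (Suc n)) * emeasure (return borel (real (Suc n))) UNIV) \<le> 1" for i
  proof -
    have "(\<Sum>n. ennreal (pmf (q i) (Suc n))) \<le> (\<Sum>n. ennreal (pmf (q i) n))"
      by (subst (2) suminf_offset[of _ 1]) auto
    also have "\<dots> = 1"
      by (simp add: nn_integral_pmf flip: nn_integral_count_space_nat)
    finally show ?thesis by (simp add: emeasure_return)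
  qed
  then have "emeasure (pmf_mixture I c q) UNIV \<le> (\<Sum>i\<in>I. ennreal (c i) * 1)"
    using c by (subst emeasure_pmf_mixture) (auto intro!: sum_mono mult_left_mono simp del: mult_1_right)
  also have "\<dots> < \<infinity>" using I by simp
  finally show "emeasure (pmf_mixture I c q) (space (pmf_mixture I c q)) \<noteq> \<infinity>"
    by (simp add: pmf_mixture_def)
qed

text \<open>Since \<open>f\<close> vanishes at \<open>0\<close>, the deleted atom can be put back,
  and integrals against the full laws \<open>q i\<close> appear. Boundedness of \<open>f\<close>
  makes each of them integrable.\<close>

lemma integral_pmf_mixture:
  fixes f :: "real \<Rightarrow> 'b::{banach, second_countable_topology}"
  assumes I: "finite I" and c: "\<And>i. i \<in> I \<Longrightarrow> 0 \<le> c i"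
    and f: "f \<in> borel_measurable borel" and C: "\<And>x. norm (f x) \<le> C" and f0: "f 0 = 0"
  shows "integral\<^sup>L (pmf_mixture I c q) f = (\<Sum>i\<in>I. c i *\<^sub>R (LINT n|measure_pmf (q i). f (real n)))"
proof -
  let ?g = "\<lambda>n. indicator {0<..} n * (\<Sum>i\<in>I. c i * pmf (q i) n)"
  have "integral\<^sup>L (pmf_mixture I c q) f = (LINT n|density (count_space UNIV) (\<lambda>n. ennreal (?g n)). f (real n))"
    unfolding pmf_mixture_def by (rule integral_distr) (auto simp: f)
  also have "\<dots> = (LINT n|count_space UNIV. ?g n *\<^sub>R f (real n))"
    using c by (intro integral_density) (auto intro!: AE_I2 sum_nonneg mult_nonneg_nonneg)
  also have "\<dots> = (LINT n|count_space UNIV. (\<Sum>i\<in>I. c i *\<^sub>R (pmf (q i) n *\<^sub>R f (real n))))"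
    by (intro Bochner_Integration.integral_cong refl)
       (auto simp: indicator_def f0 scaleR_sum_left)
  also have "\<dots> = (\<Sum>i\<in>I. LINT n|count_space UNIV. c i *\<^sub>R (pmf (q i) n *\<^sub>R f (real n)))"
  proof (rule Bochner_Integration.integral_sum)
    fix i
    have "integrable (measure_pmf (q i)) (\<lambda>n. f (real n))"
      using C by (intro measure_pmf.integrable_const_bound[of _ C]) auto
    then show "integrable (count_space UNIV) (\<lambda>n. c i *\<^sub>R (pmf (q i) n *\<^sub>R f (real n)))"
      unfolding measure_pmf_eq_density
      by (subst (asm) integrable_density) (auto simp del: scaleR_scaleR intro!: integrable_scaleR_right)
  qed
  also have "\<dots> = (\<Sum>i\<in>I. c i *\<^sub>R (LINT n|measure_pmf (q i). f (real n)))"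
    unfolding measure_pmf_eq_density
    by (subst integral_density) (auto simp del: scaleR_scaleR intro!: sum.cong integral_scaleR_right)
  finally show ?thesis .
qed

section \<open>Identification of the Levy measure\<close>

theorem proposition3p3:
  fixes P :: "'a measure"
    and M0 M :: "real \<Rightarrow> 'a \<Rightarrow> nat"
    and k0 k :: nat
    and \<mu> lam :: "nat \<Rightarrow> real"
  assumes "prob_space P"
    and "1 \<le> k0" and "\<forall>j\<in>{1..k0}. 0 < \<mu> j"
    and "1 \<le> k" and "\<forall>j\<in>{1..k}. 0 < lam j"
    and "gcp P k0 \<mu> M0"
    and "gcp P k lam M"
    and "independent_processes P M0 M"
  shows "is_levy_measure P (\<lambda>t \<omega>. real (igcp M0 M t \<omega>))
    (measure_of UNIV (sets borel)
      (\<lambda>A. \<Sum>j0=1..k0. ennreal (\<mu> j0) *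
        (\<Sum>n. \<Sum>\<nu>\<in>Omega k (Suc n).
          ennreal (\<Prod>j=1..k. (real j0 * lam j) ^ \<nu> j / fact (\<nu> j) * exp (- (real j0 * lam j))) *
          emeasure (return borel (real (Suc n))) A)))"
    (is "is_levy_measure P _ ?\<Pi>")
proof -
  interpret iterated_gcp P M0 M k0 k \<mu> lam
    using assms by (intro iterated_gcp.intro iterated_gcp_axioms.intro)
  \<comment> \<open>A jump of \<open>M0\<close> by \<open>j0\<close> runs the outer process for
    \<open>j0\<close> time units; \<open>?q j0\<close> has the generating function of
    \<open>M\<close> at time \<open>j0\<close>.\<close>
  let ?q = "\<lambda>j0. jump_pmf k (\<lambda>j. real j0 * lam j)"
  let ?N = "pmf_mixture {1..k0} \<mu> ?q"
  have pos: "0 < real j0 * lam j" if "j0 \<in> {1..k0}" "j \<in> {1..k}" for j0 j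
    using assms(5) that by simp
  have \<mu>: "0 \<le> \<mu> j0" if "j0 \<in> {1..k0}" for j0
    using assms(3) that by (simp add: less_imp_le)
  have sets: "sets ?\<Pi> = sets borel"
    by (simp add: sigma_algebra.sigma_sets_eq[OF sets.sigma_algebra_axioms[of borel, simplified]])
  \<comment> \<open>The sum over \<open>Omega k (Suc n)\<close> is the point mass of
    \<open>?q j0\<close> at \<open>Suc n\<close>, so the claimed measure is the mixture with weights
    \<open>\<mu>\<close>.\<close>
  have N: "?\<Pi> = ?N"
  proof (rule measure_eqI)
    fix A :: "real set" assume "A \<in> sets ?\<Pi>"
    then have A: "A \<in> sets borel" by (simp only: sets)
    have "emeasure ?\<Pi> A = (\<Sum>j0=1..k0. ennreal (\<mu> j0) * (\<Sum>n. \<Sum>\<nu>\<in>Omega k (Suc n).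
          ennreal (\<Prod>j=1..k. (real j0 * lam j) ^ \<nu> j / fact (\<nu> j) * exp (- (real j0 * lam j))) *
          emeasure (return borel (real (Suc n))) A))"
      by (rule emeasure_dirac_series[OF A])
    also have "\<dots> = (\<Sum>j0=1..k0. ennreal (\<mu> j0) * (\<Sum>n. ennreal (pmf (?q j0) (Suc n)) * emeasure (return borel (real (Suc n))) A))"
    proof (intro sum.cong refl arg_cong2[where f = "(*)"] suminf_cong)
      fix j0 n assume j0: "j0 \<in> {1..k0}"
      have "ennreal (pmf (?q j0) (Suc n)) = (\<Sum>\<nu>\<in>Omega k (Suc n).
          ennreal (\<Prod>j=1..k. (real j0 * lam j) ^ \<nu> j / fact (\<nu> j) * exp (- (real j0 * lam j))))"
        using pos[OF j0] by (subst pmf_jump_pmf)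
          (auto intro!: sum_ennreal[symmetric] prod_nonneg simp: less_imp_le)
      then show "(\<Sum>\<nu>\<in>Omega k (Suc n).
          ennreal (\<Prod>j=1..k. (real j0 * lam j) ^ \<nu> j / fact (\<nu> j) * exp (- (real j0 * lam j))) *
          emeasure (return borel (real (Suc n))) A) =
          ennreal (pmf (?q j0) (Suc n)) * emeasure (return borel (real (Suc n))) A"
        by (simp only: sum_distrib_right)
    qed
    also have "\<dots> = emeasure ?N A"
      by (rule emeasure_pmf_mixture[OF \<mu> A, symmetric])
    finally show "emeasure ?\<Pi> A = emeasure ?N A" .
  qed (simp only: sets sets_pmf_mixture)
  interpret N: finite_measure ?N
    using \<mu> by (intro finite_measure_pmf_mixture) auto
  have "(\<integral>\<^sup>+x. ennreal (min 1 (x\<^sup>2)) \<partial>?N) \<le> (\<integral>\<^sup>+x. 1 \<partial>?N)"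
    by (intro nn_integral_mono) simp
  also have "\<dots> < \<infinity>"
    using N.emeasure_finite by (simp add: less_top[symmetric])
  finally have fin: "(\<integral>\<^sup>+x. ennreal (min 1 (x\<^sup>2)) \<partial>?N) < \<infinity>" .
  have zero: "emeasure ?N {0} = 0"
    by (subst emeasure_pmf_mixture[OF \<mu>]) (auto simp: emeasure_return)
  define h :: "real \<Rightarrow> real" where "h x = x * indicator {-1..1} x" for x
  \<comment> \<open>The composition has neither a drift of its own nor a Gaussian part:
    \<open>b\<close> is the integral of the truncation function \<open>h\<close> against the
    mixture, chosen to cancel the compensator, and the variance is \<open>0\<close>.\<close>
  define b where "b = (\<Sum>j0=1..k0. \<mu> j0 * (LINT n|measure_pmf (?q j0). h (real n)))"
  have h [measurable]: "h \<in> borel_measurable borel" and h_le: "\<bar>h x\<bar> \<le> 1" and h0: "h 0 = 0" for x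
    by (auto simp: h_def[abs_def] indicator_def)
  have char: "char (distr P borel (X t)) \<theta> = exp (of_real t *
      (\<i> * of_real (b * \<theta>) - of_real (0 * \<theta>\<^sup>2 / 2) +
        (CLINT x|?N. iexp (\<theta> * x) - 1 - \<i> * of_real (\<theta> * x * indicator {-1..1} x))))"
    if t: "0 \<le> t" for t \<theta>
  proof -
    define v where "v = exp (- (\<Sum>j=1..k. of_real (lam j) * (1 - iexp \<theta> ^ j)))"
    let ?f = "\<lambda>x. iexp (\<theta> * x) - 1 - \<i> * of_real (\<theta> * h x)"
    have bound: "norm (?f x) \<le> 2 + \<bar>\<theta>\<bar>" for x
    proof -
      have "norm (?f x) \<le> norm (iexp (\<theta> * x)) + norm (1::complex) + norm (\<i> * of_real (\<theta> * h x))"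
        by (meson add_right_mono norm_triangle_ineq4 order_trans)
      also have "\<dots> \<le> 2 + \<bar>\<theta>\<bar>"
        using h_le[of x] by (simp add: norm_mult abs_mult mult_left_le)
      finally show ?thesis .
    qed
    have E: "(CLINT n|measure_pmf (?q j0). ?f (real n)) = v ^ j0 - 1 - \<i> * of_real (\<theta> * (LINT n|measure_pmf (?q j0). h (real n)))"
      if j0: "j0 \<in> {1..k0}" for j0
    proof -
      have i1: "integrable (measure_pmf (?q j0)) (\<lambda>n. iexp (\<theta> * real n))"
        by (rule measure_pmf.integrable_const_bound[of _ 1]) auto
      have i2: "integrable (measure_pmf (?q j0)) (\<lambda>n. h (real n))"
        using h_le by (intro measure_pmf.integrable_const_bound[of _ 1]) auto
      have "(CLINT n|measure_pmf (?q j0). iexp (\<theta> * real n)) = (CLINT n|measure_pmf (?q j0). iexp \<theta> ^ n)"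
        by (intro Bochner_Integration.integral_cong refl) (simp add: algebra_simps flip: exp_of_nat_mult)
      also have "\<dots> = exp (- (\<Sum>j=1..k. of_real (real j0 * lam j) * (1 - iexp \<theta> ^ j)))"
        using pos[OF j0] by (intro jump_pmf_pgf) auto
      \<comment> \<open>The rates of \<open>?q j0\<close> are \<open>j0\<close> times those of
        \<open>M\<close>, so the exponent is \<open>j0\<close> times the exponent in
        \<open>v\<close>.\<close>
      also have "\<dots> = v ^ j0"
        unfolding v_def exp_of_nat_mult[symmetric] by (simp add: sum_distrib_left mult.assoc)
      finally show ?thesis
        using i1 i2 by simp
    qed
    \<comment> \<open>The integrand is bounded by \<open>2 + \<bar>\<theta>\<bar>\<close> and
      vanishes at \<open>0\<close>, so the missing atom does not change the integral.\<close>
    have "(CLINT x|?N. ?f x) = (\<Sum>j0=1..k0. \<mu> j0 *\<^sub>R (CLINT n|measure_pmf (?q j0). ?f (real n)))"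
      by (rule integral_pmf_mixture[OF _ \<mu> _ bound]) (auto simp: h0)
    also have "\<dots> = (\<Sum>j0=1..k0. \<mu> j0 *\<^sub>R (v ^ j0 - 1 - \<i> * of_real (\<theta> * (LINT n|measure_pmf (?q j0). h (real n)))))"
      by (intro sum.cong refl) (simp only: E)
    also have "\<dots> = - (\<Sum>j0=1..k0. of_real (\<mu> j0) * (1 - v ^ j0)) - \<i> * of_real (b * \<theta>)"
      by (simp add: b_def scaleR_conv_of_real sum_distrib_left sum_distrib_right sum_subtractf
        algebra_simps sum.distrib)
    finally have "(CLINT x|?N. iexp (\<theta> * x) - 1 - \<i> * of_real (\<theta> * x * indicator {-1..1} x)) =
        - (\<Sum>j0=1..k0. of_real (\<mu> j0) * (1 - v ^ j0)) - \<i> * of_real (b * \<theta>)"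
      by (simp add: h_def mult.assoc)
    then show ?thesis
      unfolding char_igcp[OF t] v_def[symmetric] by simp
  qed
  show ?thesis
    unfolding is_levy_measure_def N
    by (intro conjI exI[of _ b] exI[of _ "0::real"] allI impI levy_process_igcp zero fin char) auto
qed

end
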